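(* Every irreducible real binary cubic polynomial can be transformed, by homogenization, an invertible linear change of variables, and dehomogenization, into the form $y^2=x^3+cx+d$ with $c,d\in\mathbb{R}$. That is: if $f\in\mathbb{R}[x,y]$ is an irreducible polynomial of degree $3$ and $F(x,y,z)=z^3f(x/z,y/z)\in\mathbb{R}[x,y,z]$ is its homogenization, then there exist $P\in\operatorname{GL}(3,\mathbb{R})$ and $c,d\in\mathbb{R}$ such that $F\bigl(P(x,y,z)^T\bigr)=x^3+cxz^2+dz^3-y^2z$.
   Context: Irreducible means irreducible over $\mathbb{R}$. Dehomogenization means setting $z=1$; the polynomial $x^3+cx+d-y^2$ is identified with the curve equation $y^2=x^3+cx+d$. *)

theory Defs
  imports "HOL-Analysis.Analysis" "HOL-Computational_Algebra.Computational_Algebra"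
begin

text \<open>
  \<open>\<real>[x,y]\<close> is \<open>\<real>[x][y]\<close> and \<open>\<real>[x,y,z]\<close> is \<open>\<real>[x][y][z]\<close>: the last variable is the
  main (outermost) one, so \<open>coeff (coeff f j) i\<close> is the coefficient of \<open>x\<^sup>i y\<^sup>j\<close> in \<open>f\<close>.
\<close>

type_synonym poly2 = "real poly poly"
type_synonym poly3 = "real poly poly poly"

definition const3 :: "real \<Rightarrow> poly3" where
  "const3 a = [:[:[:a:]:]:]"

definition varx :: poly3 where
  "varx = [:[:[:0, 1:]:]:]"

definition vary :: poly3 where
  "vary = [:[:0, 1:]:]"

definition varz :: poly3 where
  "varz = [:0, 1:]"

text \<open>The supremum is a maximum for \<open>f \<noteq> 0\<close>, and \<open>0\<close> for \<open>f = 0\<close>.\<close>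

definition total_degree :: "poly2 \<Rightarrow> nat" where
  "total_degree f = Sup {i + j | i j. coeff (coeff f j) i \<noteq> 0}"

text \<open>
  \<open>z\<^sup>n f(x/z, y/z)\<close> for \<open>n = total_degree f\<close>, see \<open>homogenization_eval\<close> below. The subtraction
  in the exponent truncates only in terms with zero coefficient.
\<close>

definition homogenization :: "poly2 \<Rightarrow> poly3" where
  "homogenization f =
     (\<Sum>j\<le>degree f. \<Sum>i\<le>degree (coeff f j).
        const3 (coeff (coeff f j) i) * varx ^ i * vary ^ j * varz ^ (total_degree f - (i + j)))"

text \<open>Substitution \<open>F(u, v, w)\<close> of polynomials for the variables \<open>x\<close>, \<open>y\<close>, \<open>z\<close>.\<close>

definition subst3 :: "poly3 \<Rightarrow> poly3 \<Rightarrow> poly3 \<Rightarrow> poly3 \<Rightarrow> poly3" where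
  "subst3 F u v w =
     poly (map_poly (\<lambda>g. poly (map_poly (\<lambda>h. poly (map_poly const3 h) u) g) v) F) w"

text \<open>\<open>F(P(x,y,z)\<^sup>T)\<close>; the components of \<open>P(x,y,z)\<^sup>T\<close> are the linear forms given by the rows
  (see \<open>linear_change_eval\<close>).\<close>

definition linear_form :: "real ^ 3 \<Rightarrow> poly3" where
  "linear_form r = const3 (r $ 1) * varx + const3 (r $ 2) * vary + const3 (r $ 3) * varz"

definition linear_change :: "real ^ 3 ^ 3 \<Rightarrow> poly3 \<Rightarrow> poly3" where
  "linear_change P F =
     subst3 F (linear_form (P $ 1)) (linear_form (P $ 2)) (linear_form (P $ 3))"

lemma linear_change_eval:
  fixes P :: "real ^ 3 ^ 3" and v :: "real ^ 3"
  shows "poly (poly (poly (linear_change P F) [:[:v $ 3:]:]) [:v $ 2:]) (v $ 1) =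
           poly (poly (poly F [:[:(P *v v) $ 3:]:]) [:(P *v v) $ 2:]) ((P *v v) $ 1)"
proof -
  define E where "E G = poly (poly (poly G [:[:v $ 3:]:]) [:v $ 2:]) (v $ 1)" for G :: poly3
  have ring: "E 0 = 0" "E (G + H) = E G + E H" "E (G * H) = E G * E H" "E (const3 a) = a" for G H a
    by (simp_all add: E_def const3_def)
  have c0: "const3 0 = 0" by (simp add: const3_def)
  have form: "E (linear_form (P $ k)) = (P *v v) $ k" for k
    by (simp add: linear_form_def E_def const3_def varx_def vary_def varz_def
        matrix_vector_mult_def sum_3)
  define s1 where "s1 h = poly (map_poly const3 h) (linear_form (P $ 1))" for h
  define s2 where "s2 g = poly (map_poly s1 g) (linear_form (P $ 2))" for g
  have s1: "E (s1 h) = poly h ((P *v v) $ 1)" for h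
    unfolding s1_def by (induction h) (simp_all add: map_poly_pCons c0 ring form)
  have s10: "s1 0 = 0" by (simp add: s1_def)
  have s2: "E (s2 g) = poly (poly g [:(P *v v) $ 2:]) ((P *v v) $ 1)" for g
    unfolding s2_def by (induction g) (simp_all add: map_poly_pCons s10 ring form s1)
  have s20: "s2 0 = 0" by (simp add: s2_def)
  have "E (poly (map_poly s2 F) (linear_form (P $ 3))) =
      poly (poly (poly F [:[:(P *v v) $ 3:]:]) [:(P *v v) $ 2:]) ((P *v v) $ 1)"
    by (induction F) (simp_all add: map_poly_pCons s20 ring form s2)
  thus ?thesis
    unfolding linear_change_def subst3_def s1_def[symmetric] s2_def[symmetric] E_def .
qed

lemma coeff_nonzero_le_total_degree:
  assumes "coeff (coeff f j) i \<noteq> 0"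
  shows "i + j \<le> total_degree f"
proof -
  let ?S = "{i + j | i j. coeff (coeff f j) i \<noteq> 0}"
  have "?S \<subseteq> (\<lambda>(j, i). i + j) ` (SIGMA j:{..degree f}. {..degree (coeff f j)})"
  proof
    fix n assume "n \<in> ?S"
    then obtain i j where n: "n = i + j" and c: "coeff (coeff f j) i \<noteq> 0" by blast
    have "i \<le> degree (coeff f j)" using c by (rule le_degree)
    moreover have "j \<le> degree f" using c by (intro le_degree) auto
    ultimately show "n \<in> (\<lambda>(j, i). i + j) ` (SIGMA j:{..degree f}. {..degree (coeff f j)})"
      using n by force
  qed
  hence "finite ?S" by (rule finite_subset) auto
  hence "bdd_above ?S" by (rule bdd_above_finite)
  thus ?thesis unfolding total_degree_def using assms by (intro cSup_upper) auto
qed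

lemma homogenization_eval:
  fixes a b c :: real
  assumes "c \<noteq> 0"
  shows "poly (poly (poly (homogenization f) [:[:c:]:]) [:b:]) a =
           c ^ total_degree f * poly (poly f [:b / c:]) (a / c)"
proof -
  have f: "poly (poly f [:b / c:]) (a / c) =
      (\<Sum>j\<le>degree f. \<Sum>i\<le>degree (coeff f j). coeff (coeff f j) i * (a / c) ^ i * (b / c) ^ j)"
    by (simp add: poly_altdef[of f] poly_sum poly_power poly_altdef[of "coeff f _"] sum_distrib_right)
  have h: "poly (poly (poly (homogenization f) [:[:c:]:]) [:b:]) a =
      (\<Sum>j\<le>degree f. \<Sum>i\<le>degree (coeff f j).
        coeff (coeff f j) i * a ^ i * b ^ j * c ^ (total_degree f - (i + j)))"
    unfolding homogenization_def const3_def varx_def vary_def varz_def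
    by (simp add: poly_sum poly_power mult.assoc)
  have t: "coeff (coeff f j) i * a ^ i * b ^ j * c ^ (total_degree f - (i + j)) =
      c ^ total_degree f * (coeff (coeff f j) i * (a / c) ^ i * (b / c) ^ j)" for i j
  proof (cases "coeff (coeff f j) i = 0")
    case False
    hence "c ^ total_degree f = c ^ (total_degree f - (i + j)) * (c ^ i * c ^ j)"
      using coeff_nonzero_le_total_degree[OF False] by (simp flip: power_add)
    thus ?thesis using assms by (simp add: power_divide)
  qed simp
  show ?thesis unfolding f h t by (simp add: sum_distrib_left)
qed

end

theory Submission imports Defs begin

no_notation fps_nth (infixl "$" 75)

text \<open>
  Write the homogenization as \<open>F v = T v v v\<close> with \<open>T\<close> symmetric and trilinear. Its Hessian determinant
  \<open>H\<close> is also a cubic form, so \<open>(F, H)\<close> is an odd map from the sphere to the plane and has a zero \<open>v\<close>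
  by the Borsuk-Ulam theorem: this replaces the count of the intersections of the cubic with its
  Hessian curve. If \<open>v\<close> is smooth, it is an inflection point, and the basis consisting of a tangent
  vector, \<open>v\<close> and a third vector gives the normal form. If \<open>v\<close> is singular, the curve is rational,
  parametrized by the lines through \<open>v\<close>, and a smooth inflection point is a zero of a binary cubic form.
  Irreducibility enters only through the fact that \<open>F\<close> vanishes on no plane through the origin.
\<close>

section \<open>Zeros of odd maps on the sphere and the circle\<close>

text \<open>
  The Borsuk-Ulam theorem for the 2-sphere. A nowhere zero map on the upper hemisphere, a disc, has a
  continuous logarithm \<open>h\<close>; on the boundary circle \<open>h (- z) - h z\<close> is an odd multiple of \<open>\<i>\<pi>\<close>, hence
  constant, but it is also an odd function of \<open>z\<close>.
\<close>

lemma odd_map_sphere_zero: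
  fixes f :: "real ^ 3 \<Rightarrow> complex"
  assumes cont: "continuous_on (sphere 0 1) f"
    and odd: "\<And>x. f (- x) = - f x"
  shows "\<exists>x\<in>sphere 0 1. f x = 0"
proof (rule ccontr)
  assume "\<not> ?thesis"
  then have nz: "f x \<noteq> 0" if "norm x = 1" for x using that by auto
  \<comment> \<open>\<open>p\<close> lifts the closed disc to the upper hemisphere. It is odd only
    on the boundary circle, where the third coordinate vanishes.\<close>
  define p :: "complex \<Rightarrow> real ^ 3" where
    "p z = Re z *\<^sub>R axis 1 1 + Im z *\<^sub>R axis 2 1 + sqrt (1 - (norm z)\<^sup>2) *\<^sub>R axis 3 1" for z
  have norm_p: "norm (p z) = 1" if "norm z \<le> 1" for z
  proof -
    have "(norm z)\<^sup>2 \<le> 1" using that by (simp add: power_le_one)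
    then show ?thesis
      by (simp add: p_def norm_vec_def L2_set_def sum_3 axis_def cmod_power2)
  qed
  have "continuous_on (cball 0 1) (f \<circ> p)"
    by (intro continuous_on_compose continuous_on_subset[OF cont])
      (auto simp: p_def[abs_def] norm_p[unfolded p_def] intro!: continuous_intros)
  moreover have "(f \<circ> p) z \<noteq> 0" if "z \<in> cball 0 1" for z
    using that nz[OF norm_p] by simp
  ultimately obtain h where h: "continuous_on (cball 0 1) h"
    "\<And>z. z \<in> cball 0 1 \<Longrightarrow> (f \<circ> p) z = exp (h z)"
    using continuous_logarithm_on_cball by blast
  define d where "d z = h (- z) - h z" for z
  have exp_d: "exp (d z) = - 1" if "z \<in> sphere 0 1" for z
  proof -
    have "p (- z) = - p z" using that by (simp add: p_def)
    then have "f (p (- z)) = - f (p z)" by (simp add: odd)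
    then have "exp (h (- z)) = - exp (h z)" using h(2)[of z] h(2)[of "- z"] that by simp
    then show ?thesis by (simp add: d_def exp_diff)
  qed
  have "d constant_on sphere 0 1"
  proof (rule continuous_discrete_range_constant)
    show "connected (sphere 0 (1::real) :: complex set)" by (rule connected_sphere) simp
    show "continuous_on (sphere 0 1) d" unfolding d_def
      by (intro continuous_intros continuous_on_compose2[OF h(1)]) auto
    fix x :: complex assume x: "x \<in> sphere 0 1"
    have "2 * pi \<le> norm (d y - d x)" if y: "y \<in> sphere 0 1" and ne: "d y \<noteq> d x" for y
    proof (rule ccontr)
      assume n: "\<not> 2 * pi \<le> norm (d y - d x)"
      have "\<bar>Im (d y - d x)\<bar> < 2 * pi"
        using n abs_Im_le_cmod[of "d y - d x"] by linarith
      then have "\<bar>Im (d y) - Im (d x)\<bar> < 2 * pi" by (simp only: minus_complex.sel)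
      moreover have "exp (d y) = exp (d x)" using exp_d[OF x] exp_d[OF y] by (simp only:)
      ultimately have "d y = d x" by (rule exp_complex_eqI)
      then show False using ne by simp
    qed
    then show "\<exists>e>0. \<forall>y. y \<in> sphere 0 1 \<and> d y \<noteq> d x \<longrightarrow> e \<le> norm (d y - d x)"
      by (intro exI[of _ "2 * pi"]) simp
  qed
  then have "d 1 = d (- 1)" unfolding constant_on_def by force
  then have "d 1 = 0" by (simp add: d_def)
  then show False using exp_d[of 1] by simp
qed

text \<open>Along a half circle the value changes into its negative, so the intermediate value
  theorem applies. This supplies the real zeros of binary cubic forms.\<close>

lemma odd_map_circle_zero:
  fixes h :: "real \<Rightarrow> real \<Rightarrow> real"
  assumes cont: "continuous_on UNIV (\<lambda>t. h (cos t) (sin t))"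
    and odd: "\<And>x y. h (- x) (- y) = - h x y"
  obtains x y where "x \<noteq> 0 \<or> y \<noteq> 0" "h x y = 0"
proof -
  define g where "g t = h (cos t) (sin t)" for t
  have c: "continuous_on {0..pi} g"
    unfolding g_def using cont continuous_on_subset by blast
  have "g pi = - g 0" using odd[of 1 0] by (simp add: g_def)
  then have "\<exists>t. g t = 0"
    using IVT'[of g 0 0 pi] IVT2'[of g pi 0 0] c by (cases "g 0 \<le> 0") force+
  then obtain t where "h (cos t) (sin t) = 0" by (auto simp: g_def)
  moreover have "cos t \<noteq> 0 \<or> sin t \<noteq> 0"
    using sin_cos_squared_add[of t] by force
  ultimately show ?thesis using that by blast
qed

section \<open>Bases of three-dimensional space\<close>

definition basis3 :: "real ^ 3 \<Rightarrow> real ^ 3 \<Rightarrow> real ^ 3 \<Rightarrow> bool" where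
  "basis3 u v w \<longleftrightarrow> (\<forall>x. \<exists>r s t. x = r *\<^sub>R u + s *\<^sub>R v + t *\<^sub>R w) \<and>
     (\<forall>r s t. r *\<^sub>R u + s *\<^sub>R v + t *\<^sub>R w = 0 \<longrightarrow> r = 0 \<and> s = 0 \<and> t = 0)"

lemma basis3_extend:
  assumes "v \<noteq> 0"
  obtains a b where "basis3 v a b"
proof -
  have "v $ 1 \<noteq> 0 \<or> v $ 2 \<noteq> 0 \<or> v $ 3 \<noteq> 0"
    using assms by (simp add: vec_eq_iff forall_3)
  moreover have "basis3 v (axis 2 1) (axis 3 1)" if "v $ 1 \<noteq> 0"
    unfolding basis3_def
  proof (intro conjI allI)
    fix x :: "real ^ 3"
    show "\<exists>r s t. x = r *\<^sub>R v + s *\<^sub>R axis 2 1 + t *\<^sub>R axis 3 1"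
      using that
      by (intro exI[of _ "x $ 1 / v $ 1"] exI[of _ "x $ 2 - x $ 1 / v $ 1 * v $ 2"]
          exI[of _ "x $ 3 - x $ 1 / v $ 1 * v $ 3"]) (simp add: vec_eq_iff forall_3 axis_def)
  qed (use that in \<open>auto simp: vec_eq_iff forall_3 axis_def\<close>)
  moreover have "basis3 v (axis 1 1) (axis 3 1)" if "v $ 2 \<noteq> 0"
    unfolding basis3_def
  proof (intro conjI allI)
    fix x :: "real ^ 3"
    show "\<exists>r s t. x = r *\<^sub>R v + s *\<^sub>R axis 1 1 + t *\<^sub>R axis 3 1"
      using that
      by (intro exI[of _ "x $ 2 / v $ 2"] exI[of _ "x $ 1 - x $ 2 / v $ 2 * v $ 1"]
          exI[of _ "x $ 3 - x $ 2 / v $ 2 * v $ 3"]) (simp add: vec_eq_iff forall_3 axis_def)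
  qed (use that in \<open>auto simp: vec_eq_iff forall_3 axis_def\<close>)
  moreover have "basis3 v (axis 1 1) (axis 2 1)" if "v $ 3 \<noteq> 0"
    unfolding basis3_def
  proof (intro conjI allI)
    fix x :: "real ^ 3"
    show "\<exists>r s t. x = r *\<^sub>R v + s *\<^sub>R axis 1 1 + t *\<^sub>R axis 2 1"
      using that
      by (intro exI[of _ "x $ 3 / v $ 3"] exI[of _ "x $ 1 - x $ 3 / v $ 3 * v $ 1"]
          exI[of _ "x $ 2 - x $ 3 / v $ 3 * v $ 2"]) (simp add: vec_eq_iff forall_3 axis_def)
  qed (use that in \<open>auto simp: vec_eq_iff forall_3 axis_def\<close>)
  ultimately show ?thesis using that by blast
qed

lemma basis3_change:
  assumes b: "basis3 v a b" and D: "k * m' - m * k' \<noteq> 0"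
  shows "basis3 v (k *\<^sub>R a + m *\<^sub>R b) (k' *\<^sub>R a + m' *\<^sub>R b)"
  unfolding basis3_def
proof (intro conjI allI impI)
  let ?D = "k * m' - m * k'"
  fix x
  obtain r s t where x: "x = r *\<^sub>R v + s *\<^sub>R a + t *\<^sub>R b" using b unfolding basis3_def by blast
  \<comment> \<open>The new coordinates come from Cramer's rule for the system with determinant
    \<open>?D\<close>.\<close>
  have "s = (s * m' - t * k') / ?D * k + (t * k - s * m) / ?D * k'"
    "t = (s * m' - t * k') / ?D * m + (t * k - s * m) / ?D * m'"
    using D by (simp_all add: divide_simps) (simp_all add: algebra_simps)
  then have "x = r *\<^sub>R v + ((s * m' - t * k') / ?D) *\<^sub>R (k *\<^sub>R a + m *\<^sub>R b)
      + ((t * k - s * m) / ?D) *\<^sub>R (k' *\<^sub>R a + m' *\<^sub>R b)"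
    unfolding x
    by (smt (verit, ccfv_SIG) add.assoc add.commute add.left_commute scaleR_add_left
        scaleR_add_right scaleR_scaleR)
  then show "\<exists>r s t. x = r *\<^sub>R v + s *\<^sub>R (k *\<^sub>R a + m *\<^sub>R b) + t *\<^sub>R (k' *\<^sub>R a + m' *\<^sub>R b)"
    by blast
next
  fix r s t
  assume 0: "r *\<^sub>R v + s *\<^sub>R (k *\<^sub>R a + m *\<^sub>R b) + t *\<^sub>R (k' *\<^sub>R a + m' *\<^sub>R b) = 0"
  have "r *\<^sub>R v + (s * k + t * k') *\<^sub>R a + (s * m + t * m') *\<^sub>R b = 0"
    using 0 by (simp add: algebra_simps)
  then have e: "r = 0" "s * k + t * k' = 0" "s * m + t * m' = 0"
    using b unfolding basis3_def by blast+
  have "s * (k * m' - m * k') = (s * k + t * k') * m' - (s * m + t * m') * k'"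
    "t * (k * m' - m * k') = (s * m + t * m') * k - (s * k + t * k') * m"
    by (simp_all add: algebra_simps)
  then have "s * (k * m' - m * k') = 0" "t * (k * m' - m * k') = 0" unfolding e by simp_all
  then show "r = 0" "s = 0" "t = 0" using e(1) D by simp_all
qed

section \<open>Cubic forms as symmetric trilinear maps\<close>

locale symmetric_trilinear =
  fixes T :: "real ^ 3 \<Rightarrow> real ^ 3 \<Rightarrow> real ^ 3 \<Rightarrow> real"
  assumes linear: "linear (\<lambda>u. T u v w)"
    and swap12: "T u v w = T v u w"
    and swap23: "T u v w = T u w v"
begin

lemma add1: "T (u + u') v w = T u v w + T u' v w"
  using linear_add[OF linear] .

lemma scale1: "T (r *\<^sub>R u) v w = r * T u v w"
  using linear_scale[OF linear] by simp

lemma add2: "T v (u + u') w = T v u w + T v u' w"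
  by (metis add1 swap12)

lemma scale2: "T v (r *\<^sub>R u) w = r * T v u w"
  by (metis scale1 swap12)

lemma add3: "T v w (u + u') = T v w u + T v w u'"
  by (metis add2 swap23)

lemma scale3: "T v w (r *\<^sub>R u) = r * T v w u"
  by (metis scale2 swap23)

lemma zero [simp]: "T 0 v w = 0" "T v 0 w = 0" "T v w 0 = 0"
  using scale1[of 0 0] scale2[of _ 0 0] scale3[of _ _ 0 0] by simp_all

lemmas trilinear = add1 add2 add3 scale1 scale2 scale3

lemma linear3: "linear (T v w)"
  by (intro linearI) (simp_all add: add3 scale3)

text \<open>In standard coordinates \<open>T\<close> is a polynomial in the components of its three
  arguments.\<close>

lemma continuous_on_trilinear [continuous_intros]:
  assumes "continuous_on S f" "continuous_on S g" "continuous_on S h"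
  shows "continuous_on S (\<lambda>x. T (f x) (g x) (h x))"
proof -
  have 1: "T u v w = (\<Sum>i\<in>UNIV. u $ i * T (axis i 1) v w)" for u v w
  proof -
    have "T (\<Sum>i\<in>UNIV. u $ i *\<^sub>R axis i 1) v w = (\<Sum>i\<in>UNIV. u $ i * T (axis i 1) v w)"
      by (simp add: linear_sum[OF linear] scale1)
    then show ?thesis
      by (simp add: basis_expansion flip: scalar_mult_eq_scaleR)
  qed
  have 2: "T u v w = (\<Sum>i\<in>UNIV. v $ i * T u (axis i 1) w)" for u v w
    unfolding swap12[of u v w] 1[of v u w]
    by (intro sum.cong refl arg_cong2[where f = times] swap12)
  have 3: "T u v w = (\<Sum>i\<in>UNIV. w $ i * T u v (axis i 1))" for u v w
    unfolding swap23[of u v w] 2[of u w v]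
    by (intro sum.cong refl arg_cong2[where f = times] swap23)
  have "T u v w = (\<Sum>i\<in>UNIV. u $ i * (\<Sum>j\<in>UNIV. v $ j * (\<Sum>k\<in>UNIV.
      w $ k * T (axis i 1) (axis j 1) (axis k 1))))" for u v w
    by (subst 1, subst 2, subst 3) (rule refl)
  then have "(\<lambda>x. T (f x) (g x) (h x)) =
      (\<lambda>x. \<Sum>i\<in>UNIV. f x $ i * (\<Sum>j\<in>UNIV. g x $ j * (\<Sum>k\<in>UNIV.
      h x $ k * T (axis i 1) (axis j 1) (axis k 1))))" by (intro ext)
  then show ?thesis
    by (simp only:) (intro continuous_intros assms)
qed

text \<open>Projectively: the curve \<open>T u u u = 0\<close> contains no real line.\<close>

definition no_plane :: bool where
  "no_plane \<longleftrightarrow> (\<forall>a b. (\<forall>x y. let u = x *\<^sub>R a + y *\<^sub>R b in T u u u = 0) \<longrightarrow>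
     (\<exists>x y. (x \<noteq> 0 \<or> y \<noteq> 0) \<and> x *\<^sub>R a + y *\<^sub>R b = 0))"

lemma no_planeD:
  assumes "no_plane"
    and "\<And>x y. x *\<^sub>R a + y *\<^sub>R b = 0 \<Longrightarrow> x = 0 \<and> y = 0"
  obtains x y where "T (x *\<^sub>R a + y *\<^sub>R b) (x *\<^sub>R a + y *\<^sub>R b) (x *\<^sub>R a + y *\<^sub>R b) \<noteq> 0"
  using assms unfolding no_plane_def Let_def by meson

text \<open>The three vectors become the columns of the matrix \<open>P\<close>; their independence
  gives its invertibility.\<close>

definition weierstrass_basis :: "real ^ 3 \<Rightarrow> real ^ 3 \<Rightarrow> real ^ 3 \<Rightarrow> bool" where
  "weierstrass_basis a b e \<longleftrightarrow>
     (\<forall>x y z. x *\<^sub>R a + y *\<^sub>R b + z *\<^sub>R e = 0 \<longrightarrow> x = 0 \<and> y = 0 \<and> z = 0) \<and>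
     (\<exists>c d. \<forall>x y z. let u = x *\<^sub>R a + y *\<^sub>R b + z *\<^sub>R e in
        T u u u = x ^ 3 + c * x * z ^ 2 + d * z ^ 3 - y ^ 2 * z)"

section \<open>Normal form at a smooth inflection point\<close>

text \<open>
  The hypotheses say that \<open>v\<close> is a smooth inflection point with tangent spanned by \<open>v\<close> and \<open>w\<close>.
  In the basis \<open>w, v, e\<close> the coefficients of \<open>x\<^sup>2y\<close>, \<open>xy\<^sup>2\<close>, \<open>y\<^sup>3\<close> and \<open>xyz\<close> vanish, that of \<open>y\<^sup>2z\<close> does not,
  and that of \<open>x\<^sup>3\<close> does not since otherwise the form vanishes on the tangent; replacing \<open>e\<close> then
  kills \<open>x\<^sup>2z\<close> and \<open>yz\<^sup>2\<close>.
\<close>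

lemma inflection_normal_form:
  assumes np: no_plane
    and v: "T v v v = 0" and e: "T v v e \<noteq> 0"
    and w: "w \<noteq> 0" "\<And>x. T v w x = 0"
  shows "\<exists>a b e. weierstrass_basis a b e"
proof -
  have v0: "v \<noteq> 0" using e by auto
  have w': "T v x w = 0" "T w v x = 0" "T w x v = 0" "T x w v = 0" "T x v w = 0" for x
    using w(2) by (metis swap12 swap23)+
  define A where "A = T w w w"
  have A: "A \<noteq> 0"
  proof
    assume A0: "A = 0"
    have "x = 0 \<and> y = 0" if "x *\<^sub>R w + y *\<^sub>R v = 0" for x y
    proof -
      \<comment> \<open>\<open>T v _ e\<close> kills \<open>w\<close> but not \<open>v\<close>, so
        it isolates \<open>y\<close>.\<close>
      have "T v (x *\<^sub>R w + y *\<^sub>R v) e = 0" using that by simp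
      then have "y = 0" using e by (simp add: add2 scale2 w)
      then show ?thesis using that w(1) by simp
    qed
    from no_planeD[OF np this] obtain x y where
      "T (x *\<^sub>R w + y *\<^sub>R v) (x *\<^sub>R w + y *\<^sub>R v) (x *\<^sub>R w + y *\<^sub>R v) \<noteq> 0" by blast
    then show False using A0 by (simp add: A_def trilinear v w w')
  qed
  \<comment> \<open>The real cube root exists for either sign of \<open>A\<close>; scaling
    \<open>w\<close> by it makes the coefficient of \<open>x^3\<close> equal to 1.\<close>
  define p where "p = root 3 (1 / A)"
  have p: "A * p ^ 3 = 1" using A by (simp add: p_def odd_real_root_pow)
  then have p0: "p \<noteq> 0" by auto
  \<comment> \<open>The third vector \<open>g = q w + r v + t e\<close> has three free coefficients:
    \<open>t\<close> makes \<open>3 T v v g\<close>, the coefficient of \<open>y^2 z\<close>, equal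
    to -1, \<open>r\<close> kills \<open>T v g g\<close>, and \<open>q\<close> kills
    \<open>T w w g\<close>.\<close>
  define t where "t = - 1 / (3 * T v v e)"
  have t: "3 * T v v e * t = - 1" using e by (simp add: t_def)
  define r where "r = - T v e e * t / (2 * T v v e)"
  have r: "2 * T v v e * r = - T v e e * t" using e by (simp add: r_def)
  define q where "q = - T w w e * t / A"
  have q: "A * q = - T w w e * t" using A by (simp add: q_def)
  define a where "a = p *\<^sub>R w"
  define g where "g = q *\<^sub>R w + r *\<^sub>R v + t *\<^sub>R e"
  have ev: "T e v v = T v v e" "T v e v = T v v e" by (metis swap12 swap23)+
  have gvv: "T g v v = - 1 / 3" using t
    by (simp add: g_def add1 scale1 v w w' ev mult.commute)
  have ind: "x = 0 \<and> y = 0 \<and> z = 0" if 0: "x *\<^sub>R a + y *\<^sub>R v + z *\<^sub>R g = 0" for x y z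
  proof -
    \<comment> \<open>\<open>T _ v v\<close> detects only \<open>g\<close>; afterwards
      \<open>T _ w w\<close> detects only \<open>a\<close>.\<close>
    have "T (x *\<^sub>R a + y *\<^sub>R v + z *\<^sub>R g) v v = 0" unfolding 0 by simp
    then have z: "z = 0" by (simp add: add1 scale1 gvv v w' a_def)
    have "T (x *\<^sub>R a + y *\<^sub>R v + z *\<^sub>R g) w w = 0" unfolding 0 by simp
    then have x: "x = 0" using A p0 by (simp add: add1 scale1 w a_def z flip: A_def)
    show ?thesis using x z v0 0 by simp
  qed
  have aaa: "T a a a = 1" using p by (simp add: a_def scale1 scale2 scale3 power3_eq_cube A_def mult_ac)
  have aag: "T a a g = 0"
  proof -
    have "T a a g = p\<^sup>2 * (A * q + T w w e * t)"
      by (simp add: a_def g_def scale1 scale2 scale3 add3 w w' algebra_simps power2_eq_square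
          flip: A_def)
    then show ?thesis using q by simp
  qed
  have avx: "T a v x = 0" for x by (simp add: a_def scale1 w')
  have vgg: "T v g g = 0"
  proof -
    have "T v g g = t * (2 * r * T v v e + t * T v e e)"
      by (simp add: g_def add2 add3 scale2 scale3 w w' v ev algebra_simps)
    also have "\<dots> = 0" using r by (simp add: algebra_simps)
    finally show ?thesis .
  qed
  have "T u u u = x ^ 3 + (3 * T a g g) * x * z ^ 2 + T g g g * z ^ 3 - y ^ 2 * z"
    if u: "u = x *\<^sub>R a + y *\<^sub>R v + z *\<^sub>R g" for u x y z
  proof -
    have avx': "T v a x = 0" "T v x a = 0" "T x v a = 0" "T x a v = 0" "T a x v = 0" for x
      using avx by (metis swap12 swap23)+
    have gvv': "T v v g = - 1 / 3" "T v g v = - 1 / 3"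
      using gvv by (metis swap12 swap23)+
    have aag': "T a g a = 0" "T g a a = 0" "T g v g = 0" "T g g v = 0"
      using aag vgg by (metis swap12 swap23)+
    have gga: "T g a g = T a g g" "T g g a = T a g g"
      by (metis swap12 swap23)+
    show ?thesis unfolding u
      by (simp add: trilinear aaa aag avx vgg avx' gvv' aag' gga gvv v)
       (simp add: algebra_simps power2_eq_square power3_eq_cube)
  qed
  with ind show ?thesis unfolding weierstrass_basis_def Let_def by blast
qed

section \<open>Normal form of a singular cubic\<close>

text \<open>
  Each line through the singular point \<open>v\<close> meets the curve in one further point \<open>p = u + z v\<close>. The
  equation on \<open>u\<close> and its \<open>T v\<close>-orthogonal \<open>k\<close> says that \<open>p\<close> is an inflection point.
\<close>

lemma nodal_inflection:
  assumes np: no_plane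
    and v: "\<And>x. T v v x = 0"
    and span: "\<And>x. \<exists>r s t. x = r *\<^sub>R v + s *\<^sub>R u + t *\<^sub>R k"
    and ind: "\<And>x y. x *\<^sub>R v + y *\<^sub>R k = 0 \<Longrightarrow> x = 0 \<and> y = 0"
    and uk: "T v u k = 0" and uu: "T v u u \<noteq> 0"
    and eq: "3 * T v u u * T u k k = T v k k * T u u u"
  shows "\<exists>a b e. weierstrass_basis a b e"
proof -
  have v': "T v x v = 0" "T x v v = 0" for x using v by (metis swap12 swap23)+
  have uk': "T v k u = 0" "T u v k = 0" "T u k v = 0" "T k u v = 0" "T k v u = 0"
    using uk by (metis swap12 swap23)+
  have c: "T u v u = T v u u" "T u u v = T v u u" "T k v k = T v k k" "T k k v = T v k k"
    "T k u u = T u k u" "T u u k = T u k u"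
    by (metis swap12 swap23)+
  \<comment> \<open>\<open>z\<close> puts \<open>p = u + z v\<close> on the curve, because
    \<open>T p p p = T u u u + 3 z T v u u\<close>; \<open>s\<close> solves
    \<open>T p w u = 0\<close> for \<open>w = k + s v\<close>.\<close>
  define z where "z = - T u u u / (3 * T v u u)"
  define s where "s = - T u k u / T v u u"
  define p where "p = u + z *\<^sub>R v"
  define w where "w = k + s *\<^sub>R v"
  have z: "3 * T v u u * z = - T u u u" using uu by (simp add: z_def)
  have s: "T v u u * s = - T u k u" using uu by (simp add: s_def)
  have ppp: "T p p p = 0"
    using z by (simp add: p_def trilinear v v' c algebra_simps)
  have ppv: "T p p v \<noteq> 0"
    using uu by (simp add: p_def trilinear v v' c)
  have w0: "w \<noteq> 0" using ind[of s 1] by (auto simp: w_def add.commute)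
  \<comment> \<open>\<open>T p w\<close> is tested on the spanning vectors \<open>v\<close>,
    \<open>u\<close>, \<open>k\<close>; only the last test needs \<open>eq\<close>.\<close>
  have 1: "T p w v = 0"
    by (simp add: p_def w_def trilinear v v' c uk uk')
  have 2: "T p w u = 0"
    using s by (simp add: p_def w_def trilinear v v' c uk uk' mult.commute)
  have 3: "T p w k = 0"
  proof -
    have "T p w k = T u k k + z * T v k k"
      by (simp add: p_def w_def trilinear v v' c uk uk')
    also have "\<dots> = 0" using eq uu by (simp add: z_def field_simps)
    finally show ?thesis .
  qed
  have "T p w x = 0" for x
    using span[of x] by (auto simp: add3 scale3 1 2 3)
  then show ?thesis using inflection_normal_form[OF np ppp ppv w0] by blast
qed


text \<open>Gram-Schmidt for the quadratic form of \<open>T v\<close>, which may be indefinite: if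
  \<open>a\<close> and \<open>b\<close> are both isotropic, then \<open>T v a b\<close> is nonzero
  and \<open>a + b\<close> is not isotropic.\<close>

lemma basis3_orthogonal:
  assumes v: "\<And>x. T v v x = 0" and ab: "basis3 v a b" and x: "T v x x \<noteq> 0"
  obtains a' b' where "basis3 v a' b'" "T v a' a' \<noteq> 0" "T v a' b' = 0"
proof -
  have v': "T v x v = 0" for x using v by (metis swap23)
  have ba: "T v b a = T v a b" by (rule swap23)
  have "\<exists>a' b'. basis3 v a' b' \<and> T v a' a' \<noteq> 0"
  proof -
    obtain r s t where "x = r *\<^sub>R v + s *\<^sub>R a + t *\<^sub>R b" using ab unfolding basis3_def by blast
    then have "T v a a \<noteq> 0 \<or> T v b b \<noteq> 0 \<or> T v a b \<noteq> 0"
      using x by (auto simp: add2 add3 scale2 scale3 v v' ba)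
    then consider "T v a a \<noteq> 0" | "T v b b \<noteq> 0" | "T v (a + b) (a + b) \<noteq> 0"
      by (fastforce simp: add2 add3 ba)
    then show ?thesis
    proof cases
      case 1 then show ?thesis using ab by blast
    next
      case 2
      then show ?thesis using basis3_change[OF ab, of 0 0 1 1] by force
    next
      case 3
      then show ?thesis using basis3_change[OF ab, of 1 1 1 0] by force
    qed
  qed
  then obtain a' b' where *: "basis3 v a' b'" "T v a' a' \<noteq> 0" by blast
  define c where "c = T v a' b' / T v a' a'"
  have "basis3 v a' (b' - c *\<^sub>R a')" using basis3_change[OF *(1), of 1 1 0 "- c"] by simp
  moreover have "T v a' (b' - c *\<^sub>R a') = 0"
    using add3[of v a' b' "(- c) *\<^sub>R a'"] scale3[of v a' "- c" a'] *(2) by (simp add: c_def)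
  ultimately show ?thesis using that *(2) by blast
qed

lemma singular_normal_form:
  assumes np: no_plane and v0: "v \<noteq> 0" and v: "\<And>x. T v v x = 0"
  shows "\<exists>a b e. weierstrass_basis a b e"
proof -
  have v': "T v x v = 0" "T x v v = 0" for x using v by (metis swap12 swap23)+
  \<comment> \<open>On the span of \<open>v\<close> and \<open>u\<close> the cubic is
    \<open>y^3 T u u u + 3 x y^2 T v u u\<close>, so it would otherwise vanish on a plane.\<close>
  have np_v: "T u u u \<noteq> 0" if "basis3 v u k" "T v u u = 0" for u k
  proof
    assume u: "T u u u = 0"
    have "x = 0 \<and> y = 0" if "x *\<^sub>R v + y *\<^sub>R u = 0" for x y
      using \<open>basis3 v u k\<close> that unfolding basis3_def
      by (metis add.right_neutral scaleR_zero_left)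
    then show False
    proof (rule no_planeD[OF np])
      have "T u v u = 0" "T u u v = 0" using that(2) by (metis swap12 swap23)+
      then show False if "T (x *\<^sub>R v + y *\<^sub>R u) (x *\<^sub>R v + y *\<^sub>R u) (x *\<^sub>R v + y *\<^sub>R u) \<noteq> 0" for x y
        using that u \<open>T v u u = 0\<close> by (simp add: trilinear v v')
    qed
  qed
  obtain a0 b0 where ab0: "basis3 v a0 b0" using basis3_extend[OF v0] .
  \<comment> \<open>Otherwise the curve is a cone with vertex \<open>v\<close>. A real zero of the
    binary cubic form in \<open>a0\<close>, \<open>b0\<close> then gives a line through
    \<open>v\<close> inside the curve.\<close>
  have "\<exists>x. T v x x \<noteq> 0"
  proof (rule ccontr)
    assume "\<not> ?thesis"
    then have q: "T v x x = 0" for x by blast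
    define u where "u x y = x *\<^sub>R a0 + y *\<^sub>R b0" for x y
    have "continuous_on UNIV (\<lambda>t. T (u (cos t) (sin t)) (u (cos t) (sin t)) (u (cos t) (sin t)))"
      unfolding u_def by (intro continuous_intros)
    moreover have "T (u (- x) (- y)) (u (- x) (- y)) (u (- x) (- y)) = - T (u x y) (u x y) (u x y)" for x y
    proof -
      have "u (- x) (- y) = (- 1) *\<^sub>R u x y" by (simp add: u_def)
      then show ?thesis by (simp add: scale1 scale2 scale3 del: scaleR_minus_left scaleR_minus1_left)
    qed
    ultimately obtain x y where xy: "x \<noteq> 0 \<or> y \<noteq> 0" and 0: "T (u x y) (u x y) (u x y) = 0"
      using odd_map_circle_zero[of "\<lambda>x y. T (u x y) (u x y) (u x y)"] by blast
    have "x * x + y * y \<noteq> 0" using xy by (simp add: sum_squares_eq_zero_iff)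
    then have "basis3 v (u x y) ((- y) *\<^sub>R a0 + x *\<^sub>R b0)"
      unfolding u_def by (intro basis3_change[OF ab0]) simp
    then show False using np_v q 0 by blast
  qed
  then obtain a b where ab: "basis3 v a b" and qa: "T v a a \<noteq> 0" and qab: "T v a b = 0"
    using basis3_orthogonal[OF v ab0] by blast
  have qba: "T v b a = 0" using qab by (metis swap23)
  have nodal: "\<exists>a b e. weierstrass_basis a b e" if uk: "basis3 v u k" and "T v u k = 0" "T v u u \<noteq> 0"
    "3 * T v u u * T u k k = T v k k * T u u u" for u k
  proof (rule nodal_inflection[OF np v])
    show "\<exists>r s t. x = r *\<^sub>R v + s *\<^sub>R u + t *\<^sub>R k" for x using uk by (simp add: basis3_def)
    show "x = 0 \<and> y = 0" if "x *\<^sub>R v + y *\<^sub>R k = 0" for x y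
      using uk that unfolding basis3_def by (metis add.right_neutral scaleR_zero_left)
  qed (use that in auto)
  show ?thesis
  \<comment> \<open>The degenerate case is a cusp; the other one is a node or an isolated
    point.\<close>
  proof (cases "T v b b = 0")
    case True
    have "basis3 v b a" using basis3_change[OF ab, of 0 0 1 1] by simp
    then have bbb: "T b b b \<noteq> 0" using np_v True by blast
    \<comment> \<open>With \<open>k = b\<close> and \<open>T v b b = 0\<close> the inflection
      equation reduces to \<open>T u b b = 0\<close>, which is linear in \<open>c\<close> for
      \<open>u = a + c b\<close>.\<close>
    define c where "c = - T a b b / T b b b"
    have c: "T a b b + c * T b b b = 0" using bbb by (simp add: c_def)
    have "basis3 v (a + c *\<^sub>R b) b" using basis3_change[OF ab, of 1 1 c 0] by simp
    then show ?thesis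
      by (rule nodal) (use qa c in \<open>simp_all add: trilinear qab qba True\<close>)
  next
    case False
    define \<alpha> \<beta> where "\<alpha> = T v a a" and "\<beta> = T v b b"
    define u where "u x y = x *\<^sub>R a + y *\<^sub>R b" for x y
    \<comment> \<open>\<open>k\<close> is \<open>T v\<close>-orthogonal to \<open>u\<close>, and
      \<open>T v k k\<close> is \<alpha> \<beta> times \<open>T v u u\<close>. Cancelling
      \<open>T v u u\<close> in the inflection equation leaves the binary cubic equation
      \<open>h = 0\<close>.\<close>
    define k where "k x y = (- \<beta> * y) *\<^sub>R a + (\<alpha> * x) *\<^sub>R b" for x y
    define h where "h x y = 3 * T (u x y) (k x y) (k x y) - \<alpha> * \<beta> * T (u x y) (u x y) (u x y)" for x y
    have "continuous_on UNIV (\<lambda>t. h (cos t) (sin t))"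
      unfolding h_def u_def k_def by (intro continuous_intros)
    moreover have "h (- x) (- y) = - h x y" for x y
    proof -
      have "u (- x) (- y) = (- 1) *\<^sub>R u x y" "k (- x) (- y) = (- 1) *\<^sub>R k x y"
        by (simp_all add: u_def k_def)
      then show ?thesis unfolding h_def by (simp add: scale1 scale2 scale3 del: scaleR_minus_left scaleR_minus1_left)
    qed
    ultimately obtain x y where xy: "x \<noteq> 0 \<or> y \<noteq> 0" and 0: "h x y = 0"
      using odd_map_circle_zero[of h] by blast
    define q where "q = \<alpha> * x\<^sup>2 + \<beta> * y\<^sup>2"
    have quu: "T v (u x y) (u x y) = q"
      by (simp add: u_def q_def add2 add3 scale2 scale3 qab qba power2_eq_square \<alpha>_def \<beta>_def)
    have qkk: "T v (k x y) (k x y) = \<alpha> * \<beta> * q"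
      unfolding k_def add2 add3 scale2 scale3
      by (simp add: q_def qab qba power2_eq_square algebra_simps flip: \<alpha>_def \<beta>_def)
    have quk: "T v (u x y) (k x y) = 0"
      unfolding u_def k_def add2 add3 scale2 scale3
      by (simp add: qab qba algebra_simps flip: \<alpha>_def \<beta>_def)
    \<comment> \<open>If \<open>q = 0\<close>, then \<open>u\<close> is isotropic and
      \<open>k\<close> is a multiple of it, so \<open>h\<close> is a nonzero multiple of
      \<open>T u u u\<close>, which \<open>np_v\<close> forbids to vanish.\<close>
    have q0: "q \<noteq> 0"
    proof
      assume q: "q = 0"
      have \<alpha>\<beta>: "\<alpha> \<noteq> 0" "\<beta> \<noteq> 0" using qa False by (simp_all add: \<alpha>_def \<beta>_def)
      have q': "\<beta> * y\<^sup>2 = - \<alpha> * x\<^sup>2" using q by (simp add: q_def)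
      then have x: "x \<noteq> 0" and y: "y \<noteq> 0" using \<alpha>\<beta> xy by auto
      have "k x y = (\<alpha> * x / y) *\<^sub>R u x y"
      proof -
        have "- \<beta> * y = \<alpha> * x / y * x" using q' y by (simp add: field_simps power2_eq_square)
        then show ?thesis using y by (simp add: k_def u_def scaleR_add_right)
      qed
      then have "3 * (\<alpha> * x / y)\<^sup>2 * T (u x y) (u x y) (u x y) = \<alpha> * \<beta> * T (u x y) (u x y) (u x y)"
        using 0 by (simp add: h_def scale2 scale3 power2_eq_square)
      moreover have "\<alpha> * \<beta> = - (\<alpha> * x / y)\<^sup>2"
        using q' y by (simp add: field_simps power2_eq_square)
      ultimately have "4 * (\<alpha> * x / y)\<^sup>2 * T (u x y) (u x y) (u x y) = 0" by simp
      then have "T (u x y) (u x y) (u x y) = 0" using \<alpha>\<beta> x y by simp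
      moreover have "basis3 v (u x y) ((- y) *\<^sub>R a + x *\<^sub>R b)"
        unfolding u_def using x by (intro basis3_change[OF ab])
          (simp add: sum_squares_eq_zero_iff)
      ultimately show False using np_v quu q by blast
    qed
    \<comment> \<open>The determinant of this change of basis is \<open>q\<close>.\<close>
    have "basis3 v (u x y) (k x y)"
      unfolding u_def k_def using q0
      by (intro basis3_change[OF ab]) (simp add: q_def power2_eq_square algebra_simps)
    then show ?thesis
      by (rule nodal[OF _ quk]) (use q0 0 in \<open>simp_all add: quu qkk h_def\<close>)
  qed
qed

section \<open>Existence of the normal form through the Hessian\<close>

theorem weierstrass_basis_exists:
  assumes np: no_plane
  shows "\<exists>a b e. weierstrass_basis a b e"
proof -
  \<comment> \<open>\<open>M v\<close> is the Gram matrix of \<open>T v\<close>; up to the factor 6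
    it is the Hessian matrix of the cubic at \<open>v\<close>.\<close>
  define M :: "real ^ 3 \<Rightarrow> real ^ 3 ^ 3" where "M v = (\<chi> i j. T v (axis i 1) (axis j 1))" for v
  have M: "(M v *v w) $ i = T v w (axis i 1)" for v w i
  proof -
    have "(M v *v w) $ i = (\<Sum>j\<in>UNIV. w $ j * T v (axis i 1) (axis j 1))"
      by (simp add: M_def matrix_vector_mult_def mult.commute)
    also have "\<dots> = T v (axis i 1) (\<Sum>j\<in>UNIV. w $ j *\<^sub>R axis j 1)"
      by (simp add: linear_sum[OF linear3] scale3)
    also have "\<dots> = T v (axis i 1) w"
      by (simp add: basis_expansion flip: scalar_mult_eq_scaleR)
    finally show ?thesis by (simp only: swap23[of v w])
  qed
  have "continuous_on (sphere 0 1) (\<lambda>v. Complex (T v v v) (det (M v)))"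
    unfolding Complex_eq det_3 by (intro continuous_intros) (simp_all add: M_def, (intro continuous_intros)+)
  moreover have "Complex (T (- v) (- v) (- v)) (det (M (- v))) = - Complex (T v v v) (det (M v))" for v
  proof -
    have m: "T (- x) y z = - T x y z" "T x (- y) z = - T x y z" "T x y (- z) = - T x y z" for x y z
      using scale1[of "- 1" x] scale2[of x "- 1" y] scale3[of x y "- 1" z] by simp_all
    show ?thesis by (simp add: det_3 M_def m algebra_simps complex_eq_iff)
  qed
  ultimately obtain v where "v \<in> sphere 0 1" and "Complex (T v v v) (det (M v)) = 0"
    using odd_map_sphere_zero by blast
  then have v0: "v \<noteq> 0" and vvv: "T v v v = 0" and det: "det (M v) = 0"
    by (auto simp: complex_eq_iff)
  show ?thesis
  proof (cases "\<forall>x. T v v x = 0")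
    case True
    then show ?thesis using singular_normal_form[OF np v0] by blast
  next
    case False
    then obtain e where e: "T v v e \<noteq> 0" by blast
    \<comment> \<open>A kernel vector of the Hessian matrix is the second tangent vector that an
      inflection point requires.\<close>
    obtain w where w: "w \<noteq> 0" "M v *v w = 0"
      using det invertible_det_nz[of "M v"] invertible_left_inverse[of "M v"]
        matrix_left_invertible_ker[of "M v"] by blast
    have "T v w x = 0" for x
    proof -
      have "T v w x = T v w (\<Sum>j\<in>UNIV. x $ j *\<^sub>R axis j 1)"
        by (simp add: basis_expansion flip: scalar_mult_eq_scaleR)
      also have "\<dots> = (\<Sum>j\<in>UNIV. x $ j * (M v *v w) $ j)"
        by (simp add: linear_sum[OF linear3] scale3 M)
      finally show ?thesis by (simp add: w)
    qed
    then show ?thesis using inflection_normal_form[OF np vvv e w(1)] by blast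
  qed
qed

end

section \<open>Polynomial identities from values\<close>

text \<open>A nonzero polynomial over a domain has finitely many roots. Letting \<open>g\<close>
  embed the reals as constants, the variables are removed one at a time, outermost first.\<close>

lemma poly_eqI_infinite_range:
  fixes p q :: "'a::idom poly" and g :: "real \<Rightarrow> 'a"
  assumes "inj g" and "\<And>t. poly p (g t) = poly q (g t)"
  shows "p = q"
proof (rule ccontr)
  assume "p \<noteq> q"
  then have "finite {x. poly (p - q) x = 0}" by (intro poly_roots_finite) simp
  moreover have "range g \<subseteq> {x. poly (p - q) x = 0}" using assms(2) by auto
  ultimately have "finite (range g)" by (rule rev_finite_subset)
  then show False using finite_imageD[OF _ assms(1)] infinite_UNIV_char_0 by blast
qed

lemma poly2_eqI:
  fixes p q :: poly2
  assumes "\<And>a b. poly (poly p [:b:]) a = poly (poly q [:b:]) a"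
  shows "p = q"
  by (rule poly_eqI_infinite_range[of "\<lambda>b. [:b:]"])
    (use assms in \<open>auto simp: inj_def intro!: poly_eqI_infinite_range[of id]\<close>)

lemma poly3_eqI:
  fixes p q :: poly3
  assumes "\<And>a b c. poly (poly (poly p [:[:c:]:]) [:b:]) a = poly (poly (poly q [:[:c:]:]) [:b:]) a"
  shows "p = q"
  by (rule poly_eqI_infinite_range[of "\<lambda>c. [:[:c:]:]"])
    (use assms in \<open>auto simp: inj_def intro!: poly2_eqI\<close>)

section \<open>The ternary form of a cubic polynomial and its polarization\<close>

lemma total_degree_attained:
  assumes "total_degree f \<noteq> 0"
  obtains i j where "coeff (coeff f j) i \<noteq> 0" "i + j = total_degree f"
proof -
  let ?S = "{i + j | i j. coeff (coeff f j) i \<noteq> 0}"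
  have "?S \<subseteq> {..total_degree f}" using coeff_nonzero_le_total_degree by auto
  then have fin: "finite ?S" by (rule finite_subset) simp
  \<comment> \<open>The supremum of the empty set of naturals is 0, which the hypothesis
    excludes.\<close>
  moreover have ne: "?S \<noteq> {}"
  proof
    assume "?S = {}"
    then have "total_degree f = 0" unfolding total_degree_def by (simp only: Sup_nat_empty)
    then show False using assms by simp
  qed
  ultimately have "total_degree f \<in> ?S" unfolding total_degree_def
    by (metis (mono_tags, lifting) Max_in cSup_eq_Max)
  then show ?thesis using that by force
qed

text \<open>Summation ranges independent of the degrees in \<open>f\<close> allow all ten terms to
  be written out.\<close>

lemma homogenization_cubic_eval:
  assumes "total_degree f = 3"
  shows "poly (poly (poly (homogenization f) [:[:c:]:]) [:b:]) a =
    (\<Sum>j\<le>3. \<Sum>i\<le>3 - j. coeff (coeff f j) i * a ^ i * b ^ j * c ^ (3 - (i + j)))"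
proof -
  have deg: "i + j \<le> 3" if "coeff (coeff f j) i \<noteq> 0" for i j
    using coeff_nonzero_le_total_degree[OF that] assms by simp
  have degi: "degree (coeff f j) \<le> 3 - j" for j
  proof (rule degree_le, intro allI impI)
    fix i assume "3 - j < i"
    then show "coeff (coeff f j) i = 0" using deg[of j i] by force
  qed
  have "coeff f j = 0" if "3 < j" for j
    using deg[of j] that by (intro poly_eqI) force
  then have degj: "degree f \<le> 3" by (intro degree_le) blast
  have "poly (poly (poly (homogenization f) [:[:c:]:]) [:b:]) a =
      (\<Sum>j\<le>degree f. \<Sum>i\<le>degree (coeff f j).
        coeff (coeff f j) i * a ^ i * b ^ j * c ^ (3 - (i + j)))"
    unfolding homogenization_def const3_def varx_def vary_def varz_def assms
    by (simp add: poly_sum poly_power mult.assoc)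
  also have "\<dots> = (\<Sum>j\<le>degree f. \<Sum>i\<le>3 - j. coeff (coeff f j) i * a ^ i * b ^ j * c ^ (3 - (i + j)))"
    using degi by (intro sum.cong refl sum.mono_neutral_left) (auto simp: coeff_eq_0)
  also have "\<dots> = (\<Sum>j\<le>3. \<Sum>i\<le>3 - j. coeff (coeff f j) i * a ^ i * b ^ j * c ^ (3 - (i + j)))"
    using degj by (intro sum.mono_neutral_left) (auto simp: coeff_eq_0)
  finally show ?thesis .
qed

text \<open>The symmetrization of a monomial over all six permutations; on the diagonal it is 6
  times the monomial, whence the division by 6 in \<open>cubic_polar\<close>.\<close>

definition sym3 :: "3 \<Rightarrow> 3 \<Rightarrow> 3 \<Rightarrow> real ^ 3 \<Rightarrow> real ^ 3 \<Rightarrow> real ^ 3 \<Rightarrow> real" where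
  "sym3 i j k u v w = u $ i * (v $ j * w $ k + v $ k * w $ j) + u $ j * (v $ i * w $ k + v $ k * w $ i) +
     u $ k * (v $ i * w $ j + v $ j * w $ i)"

lemma sym3_add: "sym3 i j k (u + u') v w = sym3 i j k u v w + sym3 i j k u' v w"
  unfolding sym3_def vector_add_component distrib_right by (simp only: ac_simps)

lemma sym3_scale: "sym3 i j k (r *\<^sub>R u) v w = r * sym3 i j k u v w"
  unfolding sym3_def vector_scaleR_component real_scaleR_def by (simp only: distrib_left mult.assoc)

lemma sym3_swap12: "sym3 i j k u v w = sym3 i j k v u w"
  unfolding sym3_def distrib_left by (simp only: ac_simps)

lemma sym3_swap23: "sym3 i j k u v w = sym3 i j k u w v"
  unfolding sym3_def by (simp only: ac_simps)

text \<open>The polarization of the homogenized cubic: \<open>c i j\<close> belongs to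
  \<open>x^i y^j z^(3-i-j)\<close>, and the indices of \<open>sym3\<close> list the variables of
  that monomial.\<close>

definition cubic_polar :: "poly2 \<Rightarrow> real ^ 3 \<Rightarrow> real ^ 3 \<Rightarrow> real ^ 3 \<Rightarrow> real" where
  "cubic_polar f u v w = (let c = (\<lambda>i j. coeff (coeff f j) i / 6) in
     c 3 0 * sym3 1 1 1 u v w + c 2 1 * sym3 1 1 2 u v w + c 1 2 * sym3 1 2 2 u v w +
     c 0 3 * sym3 2 2 2 u v w + c 2 0 * sym3 1 1 3 u v w + c 1 1 * sym3 1 2 3 u v w +
     c 0 2 * sym3 2 2 3 u v w + c 1 0 * sym3 1 3 3 u v w + c 0 1 * sym3 2 3 3 u v w +
     c 0 0 * sym3 3 3 3 u v w)"

lemma symmetric_trilinear_cubic_polar: "symmetric_trilinear (cubic_polar f)"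
proof
  show "cubic_polar f (u + u') v w = cubic_polar f u v w + cubic_polar f u' v w" for u u' v w
    unfolding cubic_polar_def Let_def sym3_add distrib_left by (simp only: ac_simps)
  show "cubic_polar f (r *\<^sub>R u) v w = r *\<^sub>R cubic_polar f u v w" for r u v w
    unfolding cubic_polar_def Let_def sym3_scale real_scaleR_def distrib_left by (simp only: ac_simps)
  show "cubic_polar f u v w = cubic_polar f v u w" for u v w
    unfolding cubic_polar_def Let_def sym3_swap12[of _ _ _ u v w] ..
  show "cubic_polar f u v w = cubic_polar f u w v" for u v w
    unfolding cubic_polar_def Let_def sym3_swap23[of _ _ _ u v w] ..
qed

lemma homogenization_cubic_polar:
  assumes "total_degree f = 3"
  shows "poly (poly (poly (homogenization f) [:[:u $ 3:]:]) [:u $ 2:]) (u $ 1) = cubic_polar f u u u"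
  unfolding homogenization_cubic_eval[OF assms]
  by (simp add: cubic_polar_def sym3_def numeral_eq_Suc atMost_Suc power_Suc algebra_simps)

section \<open>Irreducibility excludes planes of zeros\<close>

text \<open>This replaces spanning vectors by an equation. Take \<open>n\<close> orthogonal to both;
  an \<open>x\<close> orthogonal to \<open>n\<close> but outside the span would complete a basis
  orthogonal to \<open>n\<close>, making \<open>n\<close> orthogonal to itself.\<close>

lemma hyperplane_in_span:
  fixes a b :: "real ^ 3"
  assumes ind: "\<And>x y. x *\<^sub>R a + y *\<^sub>R b = 0 \<Longrightarrow> x = 0 \<and> y = 0"
  obtains n where "n \<noteq> 0" "\<And>x. n \<bullet> x = 0 \<Longrightarrow> \<exists>r s. x = r *\<^sub>R a + s *\<^sub>R b"
proof -
  have b0: "b \<noteq> 0" using ind[of 0 1] by auto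
  have anb: "a \<notin> span {b}"
  proof
    assume "a \<in> span {b}"
    then obtain k where "a = k *\<^sub>R b" by (auto simp: span_singleton)
    then show False using ind[of 1 "- k"] by simp
  qed
  have i2: "independent {a, b}" and ab: "a \<noteq> b"
    using anb b0 by (auto simp: independent_insert span_base)
  have "dim {a, b} < DIM(real ^ 3)"
    using dim_le_card[of "{a, b}" "{a, b}"] ab by (simp add: span_superset)
  then obtain n where n: "n \<noteq> 0" "\<And>y. y \<in> span {a, b} \<Longrightarrow> orthogonal n y"
    using orthogonal_to_subspace_exists by blast
  have "\<exists>r s. x = r *\<^sub>R a + s *\<^sub>R b" if x: "n \<bullet> x = 0" for x
  proof -
    have "x \<in> span {a, b}"
    proof (rule ccontr)
      assume nx: "x \<notin> span {a, b}"
      then have i3: "independent {x, a, b}" using i2 by (simp add: independent_insertI)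
      have "x \<noteq> a" "x \<noteq> b" using nx by (metis insertCI span_base)+
      then have "card {x, a, b} = 3" using ab by simp
      then have "dim {x, a, b} = DIM(real ^ 3)" using dim_eq_card_independent[OF i3] by simp
      then have "n \<in> span {x, a, b}" using dim_eq_full by blast
      moreover have "orthogonal n y" if "y \<in> {x, a, b}" for y
        using that x n(2) by (auto simp: orthogonal_def span_base)
      ultimately have "orthogonal n n" using orthogonal_to_span by blast
      then show False using n(1) by (simp add: orthogonal_def)
    qed
    then show ?thesis
      by (auto simp: span_breakdown_eq span_singleton) (metis add.commute diff_add_cancel)
  qed
  then show ?thesis using that n(1) by blast
qed

lemma irreducible_linear_factor:
  fixes f L :: poly2
  assumes "irreducible f" "L dvd f" "\<not> is_unit L"
  obtains c where "f = L * [:[:c:]:]"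
proof -
  obtain G where G: "f = L * G" using assms(2) by (auto elim: dvdE)
  then have "is_unit G" using irreducibleD[OF assms(1)] assms(3) by blast
  then obtain c where "G = [:[:c:]:]" by (auto simp: is_unit_poly_iff)
  then show ?thesis using that G by blast
qed

text \<open>A plane of zeros other than \<open>z = 0\<close> dehomogenizes to a line on which
  \<open>f\<close> vanishes, so its linear equation divides \<open>f\<close> and irreducibility
  leaves only a constant cofactor. On \<open>z = 0\<close> the cubic part of \<open>f\<close> would
  vanish. Both contradict total degree 3.\<close>

lemma no_plane_cubic_polar:
  assumes irr: "irreducible f" and deg: "total_degree f = 3"
  shows "symmetric_trilinear.no_plane (cubic_polar f)"
  unfolding symmetric_trilinear.no_plane_def[OF symmetric_trilinear_cubic_polar]
proof (intro allI impI, rule ccontr)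
  fix a b
  assume van: "\<forall>x y. let u = x *\<^sub>R a + y *\<^sub>R b in cubic_polar f u u u = 0"
    and "\<nexists>x y. (x \<noteq> 0 \<or> y \<noteq> 0) \<and> x *\<^sub>R a + y *\<^sub>R b = 0"
  then have "x = 0 \<and> y = 0" if "x *\<^sub>R a + y *\<^sub>R b = 0" for x y using that by blast
  then obtain n where n: "n \<noteq> 0" "\<And>x. n \<bullet> x = 0 \<Longrightarrow> \<exists>r s. x = r *\<^sub>R a + s *\<^sub>R b"
    using hyperplane_in_span by blast
  have F0: "cubic_polar f u u u = 0" if "n $ 1 * u $ 1 + n $ 2 * u $ 2 + n $ 3 * u $ 3 = 0" for u
    using n(2)[of u] that van by (auto simp: inner_vec_def sum_3 Let_def)
  have f0: "poly (poly f [:y:]) x = 0" if "n $ 1 * x + n $ 2 * y + n $ 3 = 0" for x y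
    using F0[of "vector [x, y, 1]"] that homogenization_cubic_polar[OF deg, of "vector [x, y, 1]"]
      homogenization_eval[of 1 f y x] by simp
  obtain i j where ij: "coeff (coeff f j) i \<noteq> 0" "i + j = 3"
    by (rule total_degree_attained[of f]) (use deg in simp_all)
  have ij': "i = 3 \<and> j = 0 \<or> i = 2 \<and> j = 1 \<or> i = 1 \<and> j = 2 \<or> i = 0 \<and> j = 3"
    using ij(2) by presburger
  \<comment> \<open>The line is a graph over the x-axis, a vertical line, or the line at
    infinity.\<close>
  consider "n $ 2 \<noteq> 0" | "n $ 2 = 0" "n $ 1 \<noteq> 0" | "n $ 2 = 0" "n $ 1 = 0" "n $ 3 \<noteq> 0"
    using n(1) by (auto simp: vec_eq_iff forall_3)
  then show False
  proof cases
    case 1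
    define k m where "k = - n $ 3 / n $ 2" and "m = - n $ 1 / n $ 2"
    \<comment> \<open>With \<open>y\<close> as main variable, \<open>L\<close> is
      \<open>y - (k + m x)\<close>.\<close>
    define L where "L = [:- [:k, m:], 1:]"
    have "poly f [:k, m:] = 0"
    proof (rule poly_eqI_infinite_range[of id])
      fix t
      have "poly (poly f [:k, m:]) t = poly (poly f [:k + m * t:]) t"
        by (induction f) (simp_all add: algebra_simps)
      also have "\<dots> = 0"
        using 1 by (intro f0) (simp add: k_def m_def field_simps)
      finally show "poly (poly f [:k, m:]) (id t) = poly 0 (id t)" by simp
    qed simp
    then have "L dvd f" by (simp add: L_def poly_eq_0_iff_dvd)
    moreover have "\<not> is_unit L" by (simp add: L_def is_unit_poly_iff)
    ultimately obtain c where "f = L * [:[:c:]:]" using irreducible_linear_factor[OF irr] by blast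
    then show False using ij(1) ij' by (elim disjE conjE) (simp_all add: L_def numeral_eq_Suc)
  next
    case 2
    define L :: poly2 where "L = [:[:n $ 3 / n $ 1, 1:]:]"
    have "poly (coeff f j) (- n $ 3 / n $ 1) = 0" for j
    proof -
      have "map_poly (\<lambda>g. poly g (- n $ 3 / n $ 1)) f = 0"
      proof (rule poly_eqI_infinite_range[of id])
        fix t
        have "poly (map_poly (\<lambda>g. poly g x) f) t = poly (poly f [:t:]) x" for x
          by (induction f) (simp_all add: map_poly_pCons)
        moreover have "poly (poly f [:t:]) (- n $ 3 / n $ 1) = 0"
          using 2 by (intro f0) simp
        ultimately show "poly (map_poly (\<lambda>g. poly g (- n $ 3 / n $ 1)) f) (id t) = poly 0 (id t)"
          by simp
      qed simp
      then have "coeff (map_poly (\<lambda>g. poly g (- n $ 3 / n $ 1)) f) j = 0" by simp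
      then show ?thesis by (simp add: coeff_map_poly)
    qed
    \<comment> \<open>Here \<open>L\<close> does not involve \<open>y\<close>, so divisibility is
      tested on each coefficient of \<open>f\<close>.\<close>
    then have "L dvd f" by (simp add: L_def const_poly_dvd_iff poly_eq_0_iff_dvd)
    moreover have "\<not> is_unit L" by (simp add: L_def is_unit_poly_iff)
    ultimately obtain c where "f = L * [:[:c:]:]" using irreducible_linear_factor[OF irr] by blast
    then show False using ij(1) ij' by (elim disjE conjE) (simp_all add: L_def numeral_eq_Suc)
  next
    case 3
    have e: "coeff (coeff f 0) 3 * x ^ 3 + coeff (coeff f 1) 2 * x ^ 2 * y
        + coeff (coeff f 2) 1 * x * y ^ 2 + coeff (coeff f 3) 0 * y ^ 3 = 0" for x y
      using F0[of "vector [x, y, 0]"] 3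
      by (simp add: cubic_polar_def sym3_def power2_eq_square power3_eq_cube algebra_simps)
    have "coeff (coeff f 0) 3 = 0" "coeff (coeff f 3) 0 = 0"
      "coeff (coeff f 1) 2 = 0" "coeff (coeff f 2) 1 = 0"
      using e[of 1 0] e[of 0 1] e[of 1 1] e[of 1 "- 1"] by simp_all
    then show False using ij ij' by auto
  qed
qed

section \<open>From the basis to the change of variables\<close>

theorem theorem3p12:
  fixes f :: poly2
  assumes "irreducible f" and "total_degree f = 3"
  shows "\<exists>(P :: real ^ 3 ^ 3) (c :: real) (d :: real). invertible P \<and>
           linear_change P (homogenization f) =
             varx ^ 3 + const3 c * varx * varz ^ 2 + const3 d * varz ^ 3 - vary ^ 2 * varz"
proof -
  interpret symmetric_trilinear "cubic_polar f" by (rule symmetric_trilinear_cubic_polar)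
  obtain a b e where abe: "weierstrass_basis a b e"
    using weierstrass_basis_exists no_plane_cubic_polar[OF assms] by blast
  define P :: "real ^ 3 ^ 3" where "P = (\<chi> i. vector [a $ i, b $ i, e $ i])"
  have P: "P *v v = v $ 1 *\<^sub>R a + v $ 2 *\<^sub>R b + v $ 3 *\<^sub>R e" for v
    by (simp add: P_def vec_eq_iff matrix_vector_mult_def sum_3 mult.commute)
  have "v = 0" if "P *v v = 0" for v
  proof -
    have "v $ 1 = 0 \<and> v $ 2 = 0 \<and> v $ 3 = 0"
      using abe that unfolding weierstrass_basis_def P by blast
    then show ?thesis by (simp add: vec_eq_iff forall_3)
  qed
  then have "invertible P"
    using invertible_left_inverse matrix_left_invertible_ker by blast
  moreover obtain c d where cd: "\<And>x y z. let u = x *\<^sub>R a + y *\<^sub>R b + z *\<^sub>R e in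
      cubic_polar f u u u = x ^ 3 + c * x * z ^ 2 + d * z ^ 3 - y ^ 2 * z"
    using abe unfolding weierstrass_basis_def by blast
  have "linear_change P (homogenization f) =
      varx ^ 3 + const3 c * varx * varz ^ 2 + const3 d * varz ^ 3 - vary ^ 2 * varz"
  proof (rule poly3_eqI)
    fix x y z
    define v :: "real ^ 3" where "v = vector [x, y, z]"
    have v: "v $ 1 = x" "v $ 2 = y" "v $ 3 = z" by (simp_all add: v_def)
    show "poly (poly (poly (linear_change P (homogenization f)) [:[:z:]:]) [:y:]) x =
        poly (poly (poly (varx ^ 3 + const3 c * varx * varz ^ 2 + const3 d * varz ^ 3
          - vary ^ 2 * varz) [:[:z:]:]) [:y:]) x"
      using linear_change_eval[of P "homogenization f" v] homogenization_cubic_polar[OF assms(2), of "P *v v"]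
        cd[of x y z]
      by (simp add: v P Let_def varx_def vary_def varz_def const3_def)
  qed
  ultimately show ?thesis by blast
qed

end
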